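(* Let $1<p<\infty$ and let $q\ge p$ be such that $q<\frac{Np}{N-p}$ if $p<N$, $q<\infty$ if $p=N$, and $q\le\infty$ if $p>N$. Let $\Omega\subseteq\mathbb{R}^N$ be a nonempty open Steiner symmetric set with $\Omega\neq\mathbb{R}^N$. Then $\lambda_{p,q}(\Omega)>0$. More precisely, there exists a constant $c=c(N,p,q)>0$ (depending only on $N,p,q$) such that \[ c\,\left(\frac{1}{r_\Omega}\right)^{p-N+N\frac{p}{q}}\le\lambda_{p,q}(\Omega), \] where $p/q$ is interpreted as $0$ when $q=\infty$.
   Context: Let $\{\mathbf{e}_1,\dots,\mathbf{e}_N\}$ be the canonical basis of $\mathbb{R}^N$. An open set $\Omega\subseteq\mathbb{R}^N$ is Steiner symmetric if, for every $j\in\{1,\dots,N\}$: (S1) $\Omega$ is invariant under the reflection $x\mapsto x-2\langle x,\mathbf{e}_j\rangle\mathbf{e}_j$; (S2) $\Omega$ is convex in the direction $\mathbf{e}_j$, i.e. the intersection of $\Omega$ with every line parallel to $\mathbf{e}_j$ is convex. The inradius of $\Omega$ is $r_\Omega=\sup\{r>0:\ \text{there exists a ball } B_r(x)\subseteq\Omega\}$ (it is finite for the sets considered). For $q\ge p$, \[ \lambda_{p,q}(\Omega)=\inf_{\varphi\in C^\infty_0(\Omega)}\Big\{\int_\Omega|\nabla\varphi|^p\,dx:\ \|\varphi\|_{L^q(\Omega)}=1\Big\}. \] *)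

theory Defs
  imports "HOL-Analysis.Analysis" "HOL-Probability.Essential_Supremum"
begin

definition steiner_symmetric :: "(real ^ 'n) set \<Rightarrow> bool" where
  "steiner_symmetric \<Omega> \<longleftrightarrow> open \<Omega> \<and>
     (\<forall>j. (\<lambda>x. x - (2 * (x \<bullet> axis j 1)) *\<^sub>R axis j 1) ` \<Omega> = \<Omega> \<and>
          (\<forall>x. convex (\<Omega> \<inter> {x + t *\<^sub>R axis j 1 | t. True})))"

(* Sup on the reals is unspecified for sets that are not bounded above; the inradius is only
   used for sets that do not contain arbitrarily large balls. *)
definition inradius :: "(real ^ 'n) set \<Rightarrow> real" where
  "inradius \<Omega> = Sup {r. r > 0 \<and> (\<exists>x. ball x r \<subseteq> \<Omega>)}"

definition partial_deriv :: "'n \<Rightarrow> (real ^ 'n \<Rightarrow> real) \<Rightarrow> real ^ 'n \<Rightarrow> real" where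
  "partial_deriv j f x = frechet_derivative f (at x) (axis j 1)"

definition grad :: "(real ^ 'n \<Rightarrow> real) \<Rightarrow> real ^ 'n \<Rightarrow> real ^ 'n" where
  "grad f x = (\<chi> j. partial_deriv j f x)"

fun C_k :: "nat \<Rightarrow> (real ^ 'n \<Rightarrow> real) \<Rightarrow> bool" where
  "C_k 0 f \<longleftrightarrow> continuous_on UNIV f"
| "C_k (Suc k) f \<longleftrightarrow> (\<forall>x. f differentiable (at x)) \<and> (\<forall>j. C_k k (partial_deriv j f))"

(* Smooth functions with compact support in \<Omega>, identified with their extension by zero. *)
definition test_functions :: "(real ^ 'n) set \<Rightarrow> (real ^ 'n \<Rightarrow> real) set" where
  "test_functions \<Omega> =
     {\<phi>. (\<forall>k. C_k k \<phi>) \<and> compact (closure {x. \<phi> x \<noteq> 0}) \<and> closure {x. \<phi> x \<noteq> 0} \<subseteq> \<Omega>}"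

definition Lq_norm :: "ereal \<Rightarrow> (real ^ 'n) set \<Rightarrow> (real ^ 'n \<Rightarrow> real) \<Rightarrow> ereal" where
  "Lq_norm q \<Omega> \<phi> =
     (if q = \<infinity> then esssup (restrict_space lborel \<Omega>) (\<lambda>x. ereal \<bar>\<phi> x\<bar>)
      else ereal ((LINT x:\<Omega>|lborel. \<bar>\<phi> x\<bar> powr real_of_ereal q) powr (1 / real_of_ereal q)))"

(* The infimum is taken in the extended reals, so that the infimum of the empty set is \<infinity>. *)
definition lambda_pq :: "real \<Rightarrow> ereal \<Rightarrow> (real ^ 'n) set \<Rightarrow> ereal" where
  "lambda_pq p q \<Omega> =
     (INF \<phi> \<in> {\<phi> \<in> test_functions \<Omega>. Lq_norm q \<Omega> \<phi> = 1}.
        ereal (LINT x:\<Omega>|lborel. norm (grad \<phi> x) powr p))"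

(* p/q, with the value 0 for q = \<infinity>. *)
definition exponent_ratio :: "real \<Rightarrow> ereal \<Rightarrow> real" where
  "exponent_ratio p q = (if q = \<infinity> then 0 else p / real_of_ereal q)"

end

theory Submission
  imports Defs
begin

text \<open>
  Write \<open>r\<close> for the inradius. A Steiner symmetric set is solid: with \<open>x\<close> it contains every \<open>y\<close> with
  \<open>\<bar>y\<^sub>i\<bar> \<le> \<bar>x\<^sub>i\<bar>\<close> for all \<open>i\<close>. As balls centred at the origin of radius larger than \<open>r\<close> are not contained
  in it, it misses all points whose coordinates all exceed \<open>r\<close> in absolute value. So every \<open>x\<close> has
  a cube of side \<open>r\<close> inside \<open>x + K\<close>, \<open>K = [-2r, 2r]\<^sup>N\<close>, on which a test function \<open>\<phi>\<close> vanishes (move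
  each coordinate away from \<open>0\<close> by between \<open>r\<close> and \<open>2r\<close>). Averaging \<open>\<phi>(x) - \<phi>(x + h)\<close> over this cube
  bounds \<open>\<bar>\<phi>(x)\<bar>\<close> by a multiple of the integral over \<open>t \<in> [0,1]\<close> of
  \<open>T\<^sub>t(x) = \<integral>\<^sub>K \<bar>\<nabla>\<phi>(x + t h)\<bar> dh\<close>.

  Jensen's inequality bounds the \<open>L\<^sup>p\<close> norm of \<open>T\<^sub>t\<close> uniformly in \<open>t\<close> and its sup norm by a multiple of
  \<open>t\<close> to the power \<open>-N/p\<close>, both in terms of the \<open>L\<^sup>p\<close> norm of the gradient. Interpolating, the \<open>L\<^sup>q\<close> norm
  of \<open>T\<^sub>t\<close> grows at most like \<open>t\<close> to the power \<open>-(N/p - N/q)\<close>, which is integrable on \<open>[0,1]\<close> exactly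
  in the subcritical range.
\<close>

section \<open>Steiner symmetric sets: solidity and inradius\<close>

text \<open>Reflection negates the \<open>j\<close>-th coordinate of \<open>u\<close>. The segment
  from \<open>u\<close> to its mirror image is parallel to the \<open>j\<close>-th axis, so
  directional convexity keeps it in the set, and it passes through every admissible value
  \<open>c\<close>.\<close>

lemma steiner_symmetric_replace_coord:
  fixes \<Omega> :: "(real ^ 'n) set"
  assumes "steiner_symmetric \<Omega>" "u \<in> \<Omega>" "\<bar>c\<bar> \<le> \<bar>u $ j\<bar>"
  shows "(\<chi> i. if i = j then c else u $ i) \<in> \<Omega>"
proof (cases "u $ j = 0")
  case True
  then have "(\<chi> i. if i = j then c else u $ i) = u"
    using assms(3) by (auto simp: vec_eq_iff)
  then show ?thesis using assms(2) by simp
next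
  case False
  define e :: "real ^ 'n" where "e = axis j 1"
  \<comment> \<open>Solves \<open>u $ j - 2 * s * u $ j = c\<close>, so that the convex combination
    below has \<open>j\<close>-th coordinate \<open>c\<close>.\<close>
  define s where "s = (u $ j - c) / (2 * u $ j)"
  have ue: "u \<bullet> e = u $ j" by (simp add: e_def inner_axis)
  have refl: "(\<lambda>x. x - (2 * (x \<bullet> e)) *\<^sub>R e) ` \<Omega> = \<Omega>"
    and conv: "convex (\<Omega> \<inter> {u + t *\<^sub>R e | t. True})"
    using assms(1) unfolding steiner_symmetric_def e_def by blast+
  have u': "u - (2 * (u $ j)) *\<^sub>R e \<in> \<Omega>"
    using refl assms(2) ue by (metis (mono_tags, lifting) imageI)
  have "u + 0 *\<^sub>R e \<in> \<Omega> \<inter> {u + t *\<^sub>R e | t. True}"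
    using assms(2) by auto
  moreover have "u + (- (2 * (u $ j))) *\<^sub>R e \<in> \<Omega> \<inter> {u + t *\<^sub>R e | t. True}"
    using u' by (intro IntI) (auto intro!: exI[of _ "- (2 * u $ j)"])
  moreover have "0 \<le> s" "s \<le> 1"
    using False assms(3) unfolding s_def by (auto simp: divide_simps abs_if split: if_splits)
  ultimately have "(1 - s) *\<^sub>R (u + 0 *\<^sub>R e) + s *\<^sub>R (u + (- (2 * (u $ j))) *\<^sub>R e)
      \<in> \<Omega> \<inter> {u + t *\<^sub>R e | t. True}"
    using conv by (intro convexD) auto
  moreover have "(1 - s) *\<^sub>R (u + 0 *\<^sub>R e) + s *\<^sub>R (u + (- (2 * (u $ j))) *\<^sub>R e)
      = (\<chi> i. if i = j then c else u $ i)"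
    using False by (auto simp: vec_eq_iff e_def axis_def s_def field_simps)
  ultimately show ?thesis by simp
qed

text \<open>Replace the coordinates of \<open>x\<close> by those of \<open>y\<close> one at a time;
  \<open>J\<close> collects the coordinates already replaced.\<close>

lemma steiner_symmetric_solid:
  fixes \<Omega> :: "(real ^ 'n::finite) set"
  assumes "steiner_symmetric \<Omega>" "x \<in> \<Omega>" "\<And>i. \<bar>y $ i\<bar> \<le> \<bar>x $ i\<bar>"
  shows "y \<in> \<Omega>"
proof -
  have "finite J \<Longrightarrow> (\<chi> i. if i \<in> J then y $ i else x $ i) \<in> \<Omega>" for J
  proof (induction J rule: finite_induct)
    case empty
    then show ?case using assms(2) by simp
  next
    case (insert j J)
    let ?u = "\<chi> i. if i \<in> J then y $ i else x $ i"
    have "(\<chi> i. if i = j then y $ j else ?u $ i) \<in> \<Omega>"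
      using insert assms by (intro steiner_symmetric_replace_coord) auto
    moreover have "(\<chi> i. if i = j then y $ j else ?u $ i)
        = (\<chi> i. if i \<in> insert j J then y $ i else x $ i)"
      by (auto simp: vec_eq_iff)
    ultimately show ?case by simp
  qed
  from this[of UNIV] show ?thesis by simp
qed

text \<open>Pushing every coordinate of the centre away from 0 by \<open>norm z\<close> gives a
  point that dominates \<open>z\<close> coordinatewise, so by solidity it cannot lie in the set, nor
  in the ball. This makes the supremum defining the inradius a supremum of a bounded set.\<close>

lemma steiner_symmetric_ball_radius_le:
  fixes \<Omega> :: "(real ^ 'n::finite) set"
  assumes "steiner_symmetric \<Omega>" "z \<notin> \<Omega>" "ball x \<rho> \<subseteq> \<Omega>"
  shows "\<rho> \<le> real CARD('n) * norm z"
proof (rule ccontr)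
  assume large: "\<not> ?thesis"
  define y where "y = (\<chi> i. x $ i + (if x $ i \<ge> 0 then norm z else - norm z))"
  have "norm (y - x) \<le> (\<Sum>i\<in>UNIV. \<bar>(y - x) $ i\<bar>)"
    by (rule norm_le_l1_cart)
  also have "\<dots> = (\<Sum>i\<in>(UNIV :: 'n set). norm z)"
    by (intro sum.cong) (auto simp: y_def)
  finally have "y \<in> ball x \<rho>"
    using large by (simp add: dist_norm norm_minus_commute)
  moreover have "\<bar>z $ i\<bar> \<le> \<bar>y $ i\<bar>" for i
    using component_le_norm_cart[of z i] by (auto simp: y_def)
  ultimately show False
    using steiner_symmetric_solid[of \<Omega> y z] assms by blast
qed

text \<open>If all coordinates of a point \<open>y\<close> of the set exceeded the inradius, so
  would the least of their absolute values, and by solidity the ball about 0 with that radius would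
  still lie in the set.\<close>

lemma steiner_symmetric_inradius:
  fixes \<Omega> :: "(real ^ 'n::finite) set"
  assumes "steiner_symmetric \<Omega>" "\<Omega> \<noteq> {}" "\<Omega> \<noteq> UNIV"
  shows inradius_pos: "0 < inradius \<Omega>"
    and small_coord_if_mem: "y \<in> \<Omega> \<Longrightarrow> \<exists>i. \<bar>y $ i\<bar> \<le> inradius \<Omega>"
proof -
  let ?R = "{r. r > 0 \<and> (\<exists>x. ball x r \<subseteq> \<Omega>)}"
  obtain z where z: "z \<notin> \<Omega>" using assms(3) by auto
  have bdd: "bdd_above ?R"
    using steiner_symmetric_ball_radius_le[OF assms(1) z] by (auto intro!: bdd_aboveI)
  obtain x0 where "x0 \<in> \<Omega>" using assms(2) by auto
  moreover have "open \<Omega>" using assms(1) by (simp add: steiner_symmetric_def)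
  ultimately obtain e where "e > 0" "ball x0 e \<subseteq> \<Omega>" by (meson openE)
  then have "e \<in> ?R" by auto
  then have "e \<le> inradius \<Omega>" unfolding inradius_def by (rule cSup_upper[OF _ bdd])
  with \<open>e > 0\<close> show pos: "0 < inradius \<Omega>" by simp
  show "\<exists>i. \<bar>y $ i\<bar> \<le> inradius \<Omega>" if "y \<in> \<Omega>"
  proof (rule ccontr)
    assume large: "\<not> ?thesis"
    define \<rho> where "\<rho> = Min (range (\<lambda>i. \<bar>y $ i\<bar>))"
    have "inradius \<Omega> < \<rho>"
      using large by (auto simp: \<rho>_def not_le)
    have "ball 0 \<rho> \<subseteq> \<Omega>"
    proof
      fix w :: "real ^ 'n" assume "w \<in> ball 0 \<rho>"
      then have "\<bar>w $ i\<bar> \<le> \<bar>y $ i\<bar>" for i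
        using component_le_norm_cart[of w i] by (auto simp: \<rho>_def intro: order.trans less_imp_le)
      then show "w \<in> \<Omega>" using steiner_symmetric_solid[OF assms(1) that] by blast
    qed
    then have "\<rho> \<in> ?R" using pos \<open>inradius \<Omega> < \<rho>\<close> by auto
    then have "\<rho> \<le> inradius \<Omega>" unfolding inradius_def by (rule cSup_upper[OF _ bdd])
    with \<open>inradius \<Omega> < \<rho>\<close> show False by simp
  qed
qed

section \<open>Gradients and increments along segments\<close>

lemma has_derivative_grad:
  fixes \<phi> :: "real ^ 'n::finite \<Rightarrow> real"
  assumes "\<phi> differentiable (at x)"
  shows "(\<phi> has_derivative (\<lambda>h. grad \<phi> x \<bullet> h)) (at x)"
proof -
  let ?D = "frechet_derivative \<phi> (at x)"
  have D: "(\<phi> has_derivative ?D) (at x)"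
    using assms by (simp add: frechet_derivative_works)
  then interpret linear ?D by (rule has_derivative_linear)
  have "?D h = grad \<phi> x \<bullet> h" for h
  proof -
    have "?D h = ?D (\<Sum>i\<in>UNIV. (h $ i) *\<^sub>R axis i 1)"
      using basis_expansion[of h] by (simp add: scalar_mult_eq_scaleR)
    also have "\<dots> = (\<Sum>i\<in>UNIV. h $ i * ?D (axis i 1))"
      by (simp add: sum scaleR)
    also have "\<dots> = grad \<phi> x \<bullet> h"
      by (simp add: inner_vec_def grad_def partial_deriv_def mult.commute)
    finally show ?thesis .
  qed
  then show ?thesis using D by presburger
qed

text \<open>The fundamental theorem of calculus on the segment from \<open>x\<close> to
  \<open>x + h\<close>, followed by Cauchy-Schwarz. The bound is put into \<open>ennreal\<close> so
  that Tonelli's theorem applies later without integrability conditions.\<close>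

lemma increment_le_line_integral_grad:
  fixes \<phi> :: "real ^ 'n::finite \<Rightarrow> real"
  assumes diff: "\<And>x. \<phi> differentiable (at x)" and cont: "continuous_on UNIV (grad \<phi>)"
  shows "ennreal \<bar>\<phi> (x + h) - \<phi> x\<bar>
    \<le> ennreal (norm h) * (\<integral>\<^sup>+t. indicator {0..1} t * ennreal (norm (grad \<phi> (x + t *\<^sub>R h))) \<partial>lborel)"
proof -
  define g where "g t = norm (grad \<phi> (x + t *\<^sub>R h))" for t :: real
  have "((\<lambda>t. \<phi> (x + t *\<^sub>R h)) has_vector_derivative (grad \<phi> (x + t *\<^sub>R h) \<bullet> h)) (at t within {0..1})" for t
    unfolding has_vector_derivative_def
    by (rule has_derivative_eq_rhs, rule has_derivative_compose[OF _ has_derivative_grad[OF diff]])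
       (auto intro!: derivative_eq_intros)
  then have I: "((\<lambda>t. grad \<phi> (x + t *\<^sub>R h) \<bullet> h) has_integral (\<phi> (x + 1 *\<^sub>R h) - \<phi> (x + 0 *\<^sub>R h))) {0..1}"
    by (intro fundamental_theorem_of_calculus) auto
  have contg: "continuous_on UNIV g"
    unfolding g_def by (intro continuous_intros continuous_on_compose2[OF cont]) auto
  then have "g integrable_on {0..1}"
    by (intro integrable_continuous_real) (rule continuous_on_subset, auto)
  then have Ig: "((\<lambda>t. norm h * g t) has_integral (norm h * integral {0..1} g)) {0..1}"
    by (intro has_integral_mult_right) (simp add: integrable_integral)
  have incr: "\<bar>\<phi> (x + h) - \<phi> x\<bar> \<le> norm h * integral {0..1} g"
    using integral_norm_bound_integral[of "\<lambda>t. grad \<phi> (x + t *\<^sub>R h) \<bullet> h" "{0..1}" "\<lambda>t. norm h * g t"]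
      has_integral_integrable[OF I] has_integral_integrable[OF Ig]
      Cauchy_Schwarz_ineq2[of "grad \<phi> (x + _ *\<^sub>R h)" h]
    unfolding integral_unique[OF I] integral_unique[OF Ig]
    by (simp add: g_def mult.commute[of "norm h"])
  have nn: "(\<integral>\<^sup>+t. ennreal (indicator {0..1} t * g t) \<partial>lborel) = ennreal (integral {0..1} g)"
    using \<open>g integrable_on {0..1}\<close>
    by (intro nn_integral_has_integral_lebesgue integrable_integral) (simp add: g_def)
  moreover have "(\<integral>\<^sup>+t. indicator {0..1} t * ennreal (norm (grad \<phi> (x + t *\<^sub>R h))) \<partial>lborel)
      = ennreal (integral {0..1} g)"
    unfolding nn[symmetric] by (simp add: g_def ennreal_mult' ennreal_indicator)
  moreover have "0 \<le> integral {0..1} g"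
    using \<open>g integrable_on {0..1}\<close> by (intro integral_nonneg) (auto simp: g_def)
  ultimately show ?thesis using incr
    by (simp add: ennreal_leI flip: ennreal_mult)
qed

section \<open>Jensen's inequality and changes of variables\<close>

text \<open>Jensen's inequality for the measure with density \<open>w\<close> and mass
  \<open>W\<close>. It is phrased for an arbitrary real lower bound \<open>I\<close> of the weighted
  integral, so that it can also be used to prove that this integral is finite.\<close>

lemma powr_mean_nn_integral_le:
  fixes w f :: "'a \<Rightarrow> real"
  assumes q: "1 \<le> q" and W: "0 < W" and I: "0 \<le> I"
    and [measurable]: "w \<in> borel_measurable M" "f \<in> borel_measurable M"
    and w: "\<And>x. 0 \<le> w x" and f: "\<And>x. 0 \<le> f x"
    and w_int: "(\<integral>\<^sup>+x. ennreal (w x) \<partial>M) = ennreal W"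
    and I_le: "ennreal I \<le> (\<integral>\<^sup>+x. ennreal (w x * f x) \<partial>M)"
  shows "ennreal (I powr q) \<le> ennreal (W powr (q - 1)) * (\<integral>\<^sup>+x. ennreal (w x * f x powr q) \<partial>M)"
proof (cases "(\<integral>\<^sup>+x. ennreal (w x * f x powr q) \<partial>M) = \<infinity>")
  case True
  then show ?thesis using W by (simp add: ennreal_mult_top)
next
  case False
  then obtain j where j: "0 \<le> j" "(\<integral>\<^sup>+x. ennreal (w x * f x powr q) \<partial>M) = ennreal j"
    by (cases "(\<integral>\<^sup>+x. ennreal (w x * f x powr q) \<partial>M)") auto
  \<comment> \<open>The tangent of \<open>u powr q\<close> at \<open>s\<close>; optimising \<open>s\<close> after integration gives Jensen's inequality.\<close>
  have young: "u \<le> s powr (1 - q) / q * u powr q + (1 - 1 / q) * s" if "0 \<le> u" "0 < s" for u s :: real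
  proof (cases "u = 0")
    case True
    then show ?thesis using q that by simp
  next
    case False
    then have "u = (u powr q * s powr (1 - q)) powr (1 / q) * s powr (1 - 1 / q)"
      using that q by (simp add: powr_mult powr_powr diff_divide_distrib flip: powr_add)
    also have "\<dots> \<le> (1 / q) * (u powr q * s powr (1 - q)) + (1 - 1 / q) * s"
      using that q False by (intro Youngs_inequality_0) auto
    finally show ?thesis by (simp add: mult_ac)
  qed
  have bound: "I \<le> s powr (1 - q) / q * j + (1 - 1 / q) * s * W" if "0 < s" for s
  proof -
    have "ennreal I \<le> (\<integral>\<^sup>+x. ennreal (w x * f x) \<partial>M)" by (rule I_le)
    also have "\<dots> \<le> (\<integral>\<^sup>+x. ennreal (s powr (1 - q) / q) * ennreal (w x * f x powr q)
        + ennreal ((1 - 1 / q) * s) * ennreal (w x) \<partial>M)"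
    proof (intro nn_integral_mono)
      fix x
      have "w x * f x \<le> w x * (s powr (1 - q) / q * f x powr q + (1 - 1 / q) * s)"
        using young[OF f that] w by (intro mult_left_mono)
      then have "w x * f x \<le> s powr (1 - q) / q * (w x * f x powr q) + (1 - 1 / q) * s * w x"
        by (simp add: algebra_simps)
      then show "ennreal (w x * f x) \<le> ennreal (s powr (1 - q) / q) * ennreal (w x * f x powr q)
        + ennreal ((1 - 1 / q) * s) * ennreal (w x)"
        using w q that by (simp add: ennreal_leI flip: ennreal_mult ennreal_plus)
    qed
    also have "\<dots> = ennreal (s powr (1 - q) / q) * ennreal j + ennreal ((1 - 1 / q) * s) * ennreal W"
      by (simp add: nn_integral_add nn_integral_cmult j w_int)
    also have "\<dots> = ennreal (s powr (1 - q) / q * j + (1 - 1 / q) * s * W)"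
      using q that j W by (simp flip: ennreal_mult ennreal_plus)
    finally show ?thesis
      using q that j W by (subst (asm) ennreal_le_iff) auto
  qed
  have "I powr q \<le> W powr (q - 1) * j"
  proof (cases "j = 0")
    case True
    \<comment> \<open>With \<open>j = 0\<close> only the term linear in \<open>s\<close> survives;
      letting \<open>s = e / W\<close> tend to 0 forces \<open>I = 0\<close>.\<close>
    have "I \<le> e" if "0 < e" for e
    proof -
      have "I \<le> (1 - 1 / q) * (e / W) * W"
        using bound[of "e / W"] True that W by simp
      also have "\<dots> \<le> e" using q that W by (simp add: field_simps)
      finally show ?thesis .
    qed
    then have "I = 0" using I by (meson dense_ge antisym)
    then show ?thesis using True by simp
  next
    case False
    then have "0 < j" using j by simp
    \<comment> \<open>The value balancing the two terms of \<open>bound\<close>: since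
      \<open>j = s powr q * W\<close>, their sum is exactly \<open>s * W\<close>.\<close>
    define s where "s = (j / W) powr (1 / q)"
    have s: "0 < s" using \<open>0 < j\<close> W by (simp add: s_def)
    have "s powr q = j / W" using \<open>0 < j\<close> W q by (simp add: s_def powr_powr)
    then have jeq: "j = s powr q * W" using W by simp
    have "s powr (1 - q) * s powr q = s" using s by (simp flip: powr_add)
    then have "s powr (1 - q) / q * j = s / q * W" by (simp add: jeq)
    then have "I \<le> s / q * W + (1 - 1 / q) * s * W" using bound[OF s] by (simp only:)
    then have "I \<le> s * W" by (simp add: algebra_simps)
    then have "I powr q \<le> (s * W) powr q" using I q by (intro powr_mono2) auto
    also have "\<dots> = W powr (q - 1) * j"
      using s W by (simp add: jeq powr_mult powr_diff)
    finally show ?thesis .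
  qed
  then show ?thesis using j by (simp add: ennreal_leI flip: ennreal_mult)
qed

lemma nn_integral_lborel_translate:
  fixes c :: "'a::euclidean_space"
  assumes [measurable]: "f \<in> borel_measurable borel"
  shows "(\<integral>\<^sup>+x. f (x + c) \<partial>lborel) = (\<integral>\<^sup>+x. f x \<partial>lborel)"
proof -
  have "(\<integral>\<^sup>+x. f x \<partial>lborel) = (\<integral>\<^sup>+x. f x \<partial>distr lborel borel ((+) c))"
    by (simp add: lborel_distr_plus)
  then show ?thesis by (simp add: nn_integral_distr add.commute)
qed

lemma nn_integral_lborel_dilate:
  fixes x :: "'a::euclidean_space"
  assumes [measurable]: "f \<in> borel_measurable borel" and t: "0 < t"
  shows "(\<integral>\<^sup>+h. f (x + t *\<^sub>R h) \<partial>lborel) = ennreal (t powr - real DIM('a)) * (\<integral>\<^sup>+x. f x \<partial>lborel)"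
proof -
  have "(\<integral>\<^sup>+x. f x \<partial>lborel)
      = (\<integral>\<^sup>+x. f x \<partial>density (distr lborel borel (\<lambda>h. x + t *\<^sub>R h)) (\<lambda>_. \<bar>t\<bar>^DIM('a)))"
    using t by (subst lborel_affine[of t x]) auto
  also have "\<dots> = ennreal (t ^ DIM('a)) * (\<integral>\<^sup>+h. f (x + t *\<^sub>R h) \<partial>lborel)"
    using t by (simp add: nn_integral_density nn_integral_distr nn_integral_cmult)
  finally have "ennreal (t powr - real DIM('a)) * (\<integral>\<^sup>+x. f x \<partial>lborel)
      = ennreal (t powr - real DIM('a)) * ennreal (t ^ DIM('a)) * (\<integral>\<^sup>+h. f (x + t *\<^sub>R h) \<partial>lborel)"
    by (simp add: mult.assoc)
  also have "ennreal (t powr - real DIM('a)) * ennreal (t ^ DIM('a)) = 1"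
    using t by (simp add: powr_minus powr_realpow flip: ennreal_mult)
  finally show ?thesis by simp
qed

lemma nn_integral_powr_unit_interval:
  assumes "a < 1"
  shows "(\<integral>\<^sup>+t. ennreal (indicator {0..1} t * t powr - a) \<partial>lborel) = ennreal (1 / (1 - a))"
  using has_integral_powr_from_0[of "- a" 1] assms
  by (intro nn_integral_has_integral_lebesgue) auto

section \<open>Averages over dilated sets\<close>

text \<open>The operator \<open>T\<close> of the introduction. The function \<open>g\<close> is left
  general because both the gradient norm and its \<open>p\<close>-th power are inserted.\<close>

definition dilate_integral :: "'a::euclidean_space set \<Rightarrow> ('a \<Rightarrow> real) \<Rightarrow> real \<Rightarrow> 'a \<Rightarrow> ennreal" where
  "dilate_integral K g t x = (\<integral>\<^sup>+h. ennreal (indicator K h * g (x + t *\<^sub>R h)) \<partial>lborel)"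

lemma borel_measurable_dilate_integral:
  fixes g :: "'a::euclidean_space \<Rightarrow> real"
  assumes [measurable]: "g \<in> borel_measurable borel" "K \<in> sets borel"
  shows "(\<lambda>z. dilate_integral K g (fst z) (snd z)) \<in> borel_measurable (borel \<Otimes>\<^sub>M borel)"
  unfolding dilate_integral_def by measurable

text \<open>Enlarge \<open>K\<close> to the whole space and substitute \<open>y = x + t h\<close>;
  the Jacobian is the source of the singularity at \<open>t = 0\<close>.\<close>

lemma dilate_integral_le:
  fixes g :: "'a::euclidean_space \<Rightarrow> real"
  assumes [measurable]: "g \<in> borel_measurable borel" and "\<And>x. 0 \<le> g x" "0 < t"
  shows "dilate_integral K g t x \<le> ennreal (t powr - real DIM('a)) * (\<integral>\<^sup>+x. ennreal (g x) \<partial>lborel)"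
proof -
  have "dilate_integral K g t x \<le> (\<integral>\<^sup>+h. ennreal (g (x + t *\<^sub>R h)) \<partial>lborel)"
    unfolding dilate_integral_def using assms(2)
    by (intro nn_integral_mono ennreal_leI) (auto simp: indicator_def)
  also have "\<dots> = ennreal (t powr - real DIM('a)) * (\<integral>\<^sup>+x. ennreal (g x) \<partial>lborel)"
    using assms(3) by (intro nn_integral_lborel_dilate) auto
  finally show ?thesis .
qed

text \<open>By Tonelli, each fixed \<open>h\<close> contributes the integral of a translate of
  \<open>g\<close>, so the result does not depend on \<open>t\<close>.\<close>

lemma nn_integral_dilate_integral:
  fixes g :: "'a::euclidean_space \<Rightarrow> real"
  assumes [measurable]: "g \<in> borel_measurable borel" "K \<in> sets borel" and "\<And>x. 0 \<le> g x"
  shows "(\<integral>\<^sup>+x. dilate_integral K g t x \<partial>lborel) = emeasure lborel K * (\<integral>\<^sup>+x. ennreal (g x) \<partial>lborel)"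
proof -
  have "(\<integral>\<^sup>+x. dilate_integral K g t x \<partial>lborel)
      = (\<integral>\<^sup>+h. \<integral>\<^sup>+x. ennreal (indicator K h * g (x + t *\<^sub>R h)) \<partial>lborel \<partial>lborel)"
    unfolding dilate_integral_def by (rule lborel_pair.Fubini') measurable
  also have "\<dots> = (\<integral>\<^sup>+h. indicator K h * (\<integral>\<^sup>+x. ennreal (g x) \<partial>lborel) \<partial>lborel)"
  proof (rule nn_integral_cong)
    fix h :: 'a
    have "(\<integral>\<^sup>+x. ennreal (indicator K h * g (x + t *\<^sub>R h)) \<partial>lborel)
      = (\<integral>\<^sup>+x. indicator K h * ennreal (g (x + t *\<^sub>R h)) \<partial>lborel)"
      by (intro nn_integral_cong) (simp add: indicator_def)
    also have "\<dots> = indicator K h * (\<integral>\<^sup>+x. ennreal (g x) \<partial>lborel)"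
      by (simp add: nn_integral_cmult nn_integral_lborel_translate[of "\<lambda>x. ennreal (g x)"])
    finally show "(\<integral>\<^sup>+x. ennreal (indicator K h * g (x + t *\<^sub>R h)) \<partial>lborel)
      = indicator K h * (\<integral>\<^sup>+x. ennreal (g x) \<partial>lborel)" .
  qed
  also have "\<dots> = emeasure lborel K * (\<integral>\<^sup>+x. ennreal (g x) \<partial>lborel)"
    by (simp add: nn_integral_multc)
  finally show ?thesis .
qed

lemma powr_dilate_integral_le:
  fixes g :: "'a::euclidean_space \<Rightarrow> real"
  assumes [measurable]: "g \<in> borel_measurable borel" "K \<in> sets borel" and "\<And>x. 0 \<le> g x"
    and "emeasure lborel K = ennreal \<kappa>" "0 < \<kappa>" "1 \<le> p" "0 \<le> I"
    and "ennreal I \<le> dilate_integral K g t x"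
  shows "ennreal (I powr p) \<le> ennreal (\<kappa> powr (p - 1)) * dilate_integral K (\<lambda>x. g x powr p) t x"
  unfolding dilate_integral_def
proof (rule powr_mean_nn_integral_le)
  show "(\<integral>\<^sup>+h. ennreal (indicator K h) \<partial>lborel) = ennreal \<kappa>"
    using assms by (simp add: ennreal_indicator)
qed (use assms in \<open>auto simp: dilate_integral_def\<close>)

text \<open>Jensen's inequality combined with the sup bound for the average of
  \<open>g powr p\<close>. The pointwise bound and the finiteness of the average come from the same
  estimate.\<close>

lemma dilate_integral_eq_ennreal:
  fixes g :: "'a::euclidean_space \<Rightarrow> real"
  assumes [measurable]: "g \<in> borel_measurable borel" "K \<in> sets borel" and "\<And>x. 0 \<le> g x"
    and \<kappa>: "emeasure lborel K = ennreal \<kappa>" "0 < \<kappa>" and p: "1 \<le> p" and "0 < t"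
    and G: "(\<integral>\<^sup>+x. ennreal (g x powr p) \<partial>lborel) = ennreal G" "0 \<le> G"
  obtains I where "0 \<le> I" "dilate_integral K g t x = ennreal I"
    "I powr p \<le> \<kappa> powr (p - 1) * t powr - real DIM('a) * G"
proof -
  define D where "D = \<kappa> powr (p - 1) * t powr - real DIM('a) * G"
  have le: "I powr p \<le> D" if "0 \<le> I" "ennreal I \<le> dilate_integral K g t x" for I
  proof -
    have "ennreal (I powr p) \<le> ennreal (\<kappa> powr (p - 1)) * dilate_integral K (\<lambda>x. g x powr p) t x"
      using assms that by (intro powr_dilate_integral_le) auto
    also have "\<dots> \<le> ennreal (\<kappa> powr (p - 1)) * (ennreal (t powr - real DIM('a)) * ennreal G)"
      using dilate_integral_le[of "\<lambda>x. g x powr p" t K x] assms by (intro mult_left_mono) auto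
    also have "\<dots> = ennreal D"
      using G by (simp add: D_def mult.assoc flip: ennreal_mult)
    finally show ?thesis
      using G by (subst (asm) ennreal_le_iff) (auto simp: D_def)
  qed
  have "dilate_integral K g t x \<noteq> top"
  proof
    assume top: "dilate_integral K g t x = top"
    have D: "0 \<le> D" using G by (simp add: D_def)
    \<comment> \<open>Every real number is a lower bound of an infinite average, so
      \<open>le\<close> applies to a number whose \<open>p\<close>-th power is
      \<open>D + 1\<close>.\<close>
    have "((D + 1) powr (1 / p)) powr p \<le> D" by (rule le) (auto simp: top)
    then show False using D p by (simp add: powr_powr)
  qed
  then obtain I where I: "0 \<le> I" "dilate_integral K g t x = ennreal I"
    by (cases "dilate_integral K g t x") auto
  then show ?thesis using le[of I] that by (simp add: D_def)
qed

text \<open>The average at \<open>t\<close> is at most a constant times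
  \<open>t powr - (DIM('a) / p)\<close>, which is integrable on the unit interval because the
  dimension is below \<open>p\<close>.\<close>

lemma Linfty_bound_dilate_average:
  fixes g :: "'a::euclidean_space \<Rightarrow> real"
  assumes "g \<in> borel_measurable borel" "K \<in> sets borel" "\<And>x. 0 \<le> g x"
    and \<kappa>: "emeasure lborel K = ennreal \<kappa>" "0 < \<kappa>" and p: "1 \<le> p" "real DIM('a) < p"
    and G: "(\<integral>\<^sup>+x. ennreal (g x powr p) \<partial>lborel) = ennreal G" "0 \<le> G"
    and u: "0 \<le> u" "ennreal u \<le> (\<integral>\<^sup>+t. indicator {0..1} t * dilate_integral K g t x \<partial>lborel)"
  shows "u \<le> 1 / (1 - real DIM('a) / p) * (\<kappa> powr (p - 1) * G) powr (1 / p)"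
proof -
  define C where "C = (\<kappa> powr (p - 1) * G) powr (1 / p)"
  have "ennreal u \<le> (\<integral>\<^sup>+t. indicator {0..1} t * dilate_integral K g t x \<partial>lborel)"
    by (rule u)
  also have "\<dots> \<le> (\<integral>\<^sup>+t. ennreal C * ennreal (indicator {0..1} t * t powr - (real DIM('a) / p)) \<partial>lborel)"
  \<comment> \<open>The point \<open>t = 0\<close> has to be discarded: \<open>0 powr x\<close> is 0
    by convention, so the right-hand side vanishes there.\<close>
  proof (rule nn_integral_mono_AE, rule AE_mp[OF AE_lborel_singleton[of 0]], intro AE_I2 impI)
    fix t :: real assume "t \<noteq> 0"
    show "indicator {0..1} t * dilate_integral K g t x
        \<le> ennreal C * ennreal (indicator {0..1} t * t powr - (real DIM('a) / p))"
    proof (cases "t \<in> {0..1}")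
      case True
      with \<open>t \<noteq> 0\<close> have t: "0 < t" by simp
      obtain I where I: "0 \<le> I" "dilate_integral K g t x = ennreal I"
        "I powr p \<le> \<kappa> powr (p - 1) * t powr - real DIM('a) * G"
        using dilate_integral_eq_ennreal[OF assms(1-3) \<kappa> p(1) t G] by metis
      have "I = (I powr p) powr (1 / p)" using I p by (simp add: powr_powr)
      also have "\<dots> \<le> (\<kappa> powr (p - 1) * t powr - real DIM('a) * G) powr (1 / p)"
        using I p by (intro powr_mono2) auto
      also have "\<dots> = C * t powr - (real DIM('a) / p)"
        using G by (simp add: C_def powr_mult powr_powr)
      finally show ?thesis using True I by (simp add: C_def ennreal_leI flip: ennreal_mult)
    qed simp
  qed
  also have "\<dots> = ennreal C * ennreal (1 / (1 - real DIM('a) / p))"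
    using p by (subst nn_integral_cmult) (auto simp: nn_integral_powr_unit_interval)
  also have "\<dots> = ennreal (1 / (1 - real DIM('a) / p) * C)"
    using p by (simp add: C_def mult.commute flip: ennreal_mult)
  finally show ?thesis
    using p by (subst (asm) ennreal_le_iff) (auto simp: C_def)
qed

text \<open>Interpolation between the sup bound and the integral bound shows that
  \<open>t powr a\<close> times the average is bounded in the \<open>q\<close>-norm uniformly in
  \<open>t\<close>; since \<open>a < 1\<close>, the weight \<open>t powr - a\<close> is
  integrable.\<close>

lemma Lq_bound_dilate_average:
  fixes g u :: "'a::euclidean_space \<Rightarrow> real" and p q a :: real
  defines "a \<equiv> real DIM('a) * (1 / p - 1 / q)"
  assumes meas [measurable]: "g \<in> borel_measurable borel" "K \<in> sets borel"
    and g: "\<And>x. 0 \<le> g x"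
    and \<kappa>: "emeasure lborel K = ennreal \<kappa>" "0 < \<kappa>" and p: "1 \<le> p" "p \<le> q" and a: "a < 1"
    and G: "(\<integral>\<^sup>+x. ennreal (g x powr p) \<partial>lborel) = ennreal G" "0 \<le> G"
    and u: "\<And>x. 0 \<le> u x"
      "\<And>x. ennreal (u x) \<le> (\<integral>\<^sup>+t. indicator {0..1} t * dilate_integral K g t x \<partial>lborel)"
  shows "(\<integral>\<^sup>+x. ennreal (u x powr q) \<partial>lborel)
    \<le> ennreal ((1 / (1 - a)) powr q * \<kappa> powr (1 + (p - 1) * q / p) * G powr (q / p))"
proof -
  define A where "A = 1 / (1 - a)"
  have A: "0 < A" using a by (simp add: A_def)
  define T where "T t x = enn2real (dilate_integral K g t x)" for t x
  define P where "P t x = dilate_integral K (\<lambda>x. g x powr p) t x" for t x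
  define w :: "real \<Rightarrow> real" where "w t = indicator {0..1} t * t powr - a" for t
  define C where "C = (\<kappa> powr (p - 1)) powr (q / p) * G powr (q / p - 1)"
  have q: "1 \<le> q" using p by simp
  have meas_box: "(\<lambda>z. dilate_integral K g' (fst z) (snd z)) \<in> borel_measurable (borel \<Otimes>\<^sub>M borel)"
    if "g' \<in> borel_measurable borel" for g'
    using that meas(2) by (rule borel_measurable_dilate_integral)
  have T_meas [measurable]: "(\<lambda>z. T (fst z) (snd z)) \<in> borel_measurable (borel \<Otimes>\<^sub>M borel)"
    unfolding T_def by (intro borel_measurable_enn2real meas_box) simp
  have [measurable]: "(\<lambda>z. T (snd z) (fst z)) \<in> borel_measurable (borel \<Otimes>\<^sub>M borel)"
    using measurable_pair_swap[OF T_meas] by (simp add: case_prod_beta')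
  have [measurable]: "(\<lambda>t. T t x) \<in> borel_measurable borel" for x
    using measurable_Pair1[OF T_meas, of x] by simp
  have T_nonneg: "0 \<le> T t x" for t x by (simp add: T_def)
  have T_pow: "ennreal (t powr (a * q) * T t x powr q) \<le> ennreal C * P t x"
    and T_eq: "dilate_integral K g t x = ennreal (T t x)" if t: "0 < t" for t x
  proof -
    obtain I where I: "0 \<le> I" "dilate_integral K g t x = ennreal I"
      "I powr p \<le> \<kappa> powr (p - 1) * t powr - real DIM('a) * G"
      using dilate_integral_eq_ennreal[OF meas g \<kappa> p(1) t G] by metis
    then have TI: "T t x = I" by (simp add: T_def)
    show "dilate_integral K g t x = ennreal (T t x)" by (simp add: TI I)
    show "ennreal (t powr (a * q) * T t x powr q) \<le> ennreal C * P t x"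
    proof (cases "I = 0")
      case True
      then show ?thesis using q by (simp add: TI)
    next
      case False
      then have "I powr p > 0" using I by simp
      then have "0 < \<kappa> powr (p - 1) * t powr - real DIM('a) * G" using I by linarith
      then have "0 < G" using t \<kappa> G by (simp add: zero_less_mult_iff)
      define D where "D = (\<kappa> powr (p - 1) * t powr - real DIM('a) * G) powr (q / p - 1)"
      \<comment> \<open>The interpolation: the first factor is kept for integration in
        \<open>x\<close>, the second is estimated by the sup bound.\<close>
      have "I powr q = I powr p * (I powr p) powr (q / p - 1)"
        using p by (simp add: powr_powr right_diff_distrib flip: powr_add)
      also have "\<dots> \<le> I powr p * D"
        using I p unfolding D_def by (intro mult_left_mono powr_mono2) auto
      finally have "t powr (a * q) * I powr q \<le> (t powr (a * q) * D) * I powr p"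
        using t by (simp add: mult_ac)
      also have "t powr (a * q) * D = (\<kappa> powr (p - 1)) powr (q / p - 1) * G powr (q / p - 1)"
      proof -
        \<comment> \<open>The choice of \<open>a\<close> makes the powers of \<open>t\<close>
          cancel.\<close>
        have "a * q = real DIM('a) * (q / p - 1)"
          using p by (simp add: a_def field_simps)
        then show ?thesis
          using t by (simp add: D_def powr_mult powr_powr flip: powr_add)
      qed
      finally have "ennreal (t powr (a * q) * T t x powr q)
        \<le> ennreal ((\<kappa> powr (p - 1)) powr (q / p - 1) * G powr (q / p - 1)) * ennreal (I powr p)"
        by (simp add: TI ennreal_leI flip: ennreal_mult)
      \<comment> \<open>Jensen's inequality for the remaining factor supplies one more
        \<open>\<kappa> powr (p - 1)\<close>, which completes the constant \<open>C\<close>.\<close>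
      also have "\<dots> \<le> ennreal ((\<kappa> powr (p - 1)) powr (q / p - 1) * G powr (q / p - 1))
          * (ennreal (\<kappa> powr (p - 1)) * P t x)"
        unfolding P_def using meas g \<kappa> p I
        by (intro mult_left_mono powr_dilate_integral_le) auto
      also have "\<dots> = ennreal C * P t x"
        using \<kappa> by (simp add: C_def mult.assoc[symmetric] powr_diff flip: ennreal_mult)
      finally show ?thesis .
    qed
  qed
  have w_int: "(\<integral>\<^sup>+t. ennreal (w t) \<partial>lborel) = ennreal A"
    unfolding w_def A_def by (rule nn_integral_powr_unit_interval[OF a])
  \<comment> \<open>Jensen with weight \<open>t powr - a\<close> replaces Minkowski's integral inequality.\<close>
  have pointwise: "ennreal (u x powr q)
      \<le> ennreal (A powr (q - 1)) * (\<integral>\<^sup>+t. ennreal (w t * (t powr a * T t x) powr q) \<partial>lborel)" for x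
  proof (rule powr_mean_nn_integral_le[OF q A u(1) _ _ _ _ w_int])
    have "(\<integral>\<^sup>+t. indicator {0..1} t * dilate_integral K g t x \<partial>lborel)
        = (\<integral>\<^sup>+t. ennreal (w t * (t powr a * T t x)) \<partial>lborel)"
    proof (rule nn_integral_cong_AE, rule AE_mp[OF AE_lborel_singleton[of 0]], intro AE_I2 impI)
      fix t :: real assume "t \<noteq> 0"
      then show "indicator {0..1} t * dilate_integral K g t x = ennreal (w t * (t powr a * T t x))"
        using T_eq[of t x]
        by (auto simp: w_def indicator_def powr_minus mult.assoc[symmetric] simp flip: ennreal_mult)
    qed
    then show "ennreal (u x) \<le> (\<integral>\<^sup>+t. ennreal (w t * (t powr a * T t x)) \<partial>lborel)"
      using u(2)[of x] by simp
  qed (auto simp: w_def T_nonneg)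
  have "(\<integral>\<^sup>+x. (\<integral>\<^sup>+t. ennreal (w t * (t powr a * T t x) powr q) \<partial>lborel) \<partial>lborel)
      = (\<integral>\<^sup>+t. (\<integral>\<^sup>+x. ennreal (w t * (t powr a * T t x) powr q) \<partial>lborel) \<partial>lborel)"
    unfolding w_def by (rule lborel_pair.Fubini') measurable
  also have "\<dots> \<le> (\<integral>\<^sup>+t. ennreal (w t) * ennreal (C * (\<kappa> * G)) \<partial>lborel)"
  proof (rule nn_integral_mono)
    fix t :: real
    show "(\<integral>\<^sup>+x. ennreal (w t * (t powr a * T t x) powr q) \<partial>lborel) \<le> ennreal (w t) * ennreal (C * (\<kappa> * G))"
    proof (cases "0 < t")
      case False
      \<comment> \<open>This includes \<open>t = 0\<close>, where \<open>t powr - a\<close> is 0 by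
        convention.\<close>
      then have "w t = 0" by (auto simp: w_def indicator_def)
      then show ?thesis by simp
    next
      case True
      have "(\<integral>\<^sup>+x. ennreal (w t * (t powr a * T t x) powr q) \<partial>lborel)
          \<le> (\<integral>\<^sup>+x. ennreal (w t) * ennreal C * P t x \<partial>lborel)"
      proof (rule nn_integral_mono)
        fix x
        have "ennreal (w t * (t powr a * T t x) powr q)
            = ennreal (w t) * ennreal (t powr (a * q) * T t x powr q)"
          using True T_nonneg[of t x]
          by (simp add: powr_mult powr_powr w_def flip: ennreal_mult)
        also have "\<dots> \<le> ennreal (w t) * (ennreal C * P t x)"
          by (intro mult_left_mono T_pow True) auto
        finally show "ennreal (w t * (t powr a * T t x) powr q) \<le> ennreal (w t) * ennreal C * P t x"
          by (simp add: mult.assoc)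
      qed
      also have "\<dots> = ennreal (w t) * ennreal C * (\<integral>\<^sup>+x. P t x \<partial>lborel)"
      proof (rule nn_integral_cmult)
        show "P t \<in> borel_measurable lborel"
          using measurable_compose[OF measurable_Pair1'[of t borel borel] meas_box[of "\<lambda>x. g x powr p"]]
          by (simp add: P_def[abs_def])
      qed
      \<comment> \<open>The integral in \<open>x\<close> is free of \<open>t\<close>, so only the
        mass \<open>A\<close> of the weight remains to be integrated in \<open>t\<close>.\<close>
      also have "(\<integral>\<^sup>+x. P t x \<partial>lborel) = ennreal \<kappa> * ennreal G"
        unfolding P_def by (subst nn_integral_dilate_integral) (auto simp: \<kappa> G)
      also have "ennreal (w t) * ennreal C * (ennreal \<kappa> * ennreal G) = ennreal (w t) * ennreal (C * (\<kappa> * G))"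
        using \<kappa> G by (simp add: C_def mult.assoc flip: ennreal_mult)
      finally show ?thesis .
    qed
  qed
  also have "\<dots> = ennreal A * ennreal (C * (\<kappa> * G))"
    unfolding w_int[symmetric] by (rule nn_integral_multc) (simp add: w_def)
  finally have inner: "(\<integral>\<^sup>+x. (\<integral>\<^sup>+t. ennreal (w t * (t powr a * T t x) powr q) \<partial>lborel) \<partial>lborel)
      \<le> ennreal A * ennreal (C * (\<kappa> * G))" .
  have "(\<integral>\<^sup>+x. ennreal (u x powr q) \<partial>lborel)
      \<le> (\<integral>\<^sup>+x. ennreal (A powr (q - 1)) * (\<integral>\<^sup>+t. ennreal (w t * (t powr a * T t x) powr q) \<partial>lborel) \<partial>lborel)"
    by (intro nn_integral_mono pointwise)
  also have "\<dots> = ennreal (A powr (q - 1)) *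
      (\<integral>\<^sup>+x. (\<integral>\<^sup>+t. ennreal (w t * (t powr a * T t x) powr q) \<partial>lborel) \<partial>lborel)"
    unfolding w_def by (rule nn_integral_cmult) measurable
  also have "\<dots> \<le> ennreal (A powr (q - 1)) * (ennreal A * ennreal (C * (\<kappa> * G)))"
    by (intro mult_left_mono inner) simp
  also have "\<dots> = ennreal (A powr (q - 1) * (A * (C * (\<kappa> * G))))"
    using A \<kappa> G by (simp add: C_def flip: ennreal_mult)
  also have "A powr (q - 1) * (A * (C * (\<kappa> * G))) = A powr q * \<kappa> powr (1 + (p - 1) * q / p) * G powr (q / p)"
  proof -
    have "A powr (q - 1) * A = A powr q" using A by (simp add: powr_diff)
    moreover have "G powr (q / p - 1) * G = G powr (q / p)" using G by (cases "G = 0") (simp_all add: powr_diff)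
    moreover have "(\<kappa> powr (p - 1)) powr (q / p) * \<kappa> = \<kappa> powr (1 + (p - 1) * q / p)"
      using \<kappa> by (simp add: powr_powr powr_add)
    moreover have "A powr (q - 1) * (A * (C * (\<kappa> * G)))
        = (A powr (q - 1) * A) * ((\<kappa> powr (p - 1)) powr (q / p) * \<kappa>) * (G powr (q / p - 1) * G)"
      by (simp add: C_def mult_ac)
    ultimately show ?thesis by (simp only:)
  qed
  finally show ?thesis by (simp only: A_def)
qed

section \<open>Test functions and the averaging cube\<close>

lemma test_function_regular:
  fixes \<phi> :: "real ^ 'n::finite \<Rightarrow> real"
  assumes "\<phi> \<in> test_functions \<Omega>"
  shows test_function_differentiable: "\<phi> differentiable (at x)"
    and test_function_continuous_grad: "continuous_on UNIV (grad \<phi>)"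
proof -
  have 1: "C_k (Suc 0) \<phi>" and 0: "C_k 0 \<phi>"
    using assms unfolding test_functions_def by blast+
  show "\<phi> differentiable (at x)" using 1 by simp
  show "continuous_on UNIV (grad \<phi>)"
    using 1 unfolding grad_def by (intro continuous_on_vec_lambda) simp
qed

text \<open>The complement of the closed support is open, so the function agrees with 0 near
  \<open>x\<close> and has the same derivative there.\<close>

lemma zero_outside_support:
  fixes \<phi> :: "real ^ 'n::finite \<Rightarrow> real"
  assumes "x \<notin> closure {x. \<phi> x \<noteq> 0}"
  shows "\<phi> x = 0" "grad \<phi> x = 0"
proof -
  define U where "U = - closure {x. \<phi> x \<noteq> 0}"
  have zero: "\<phi> y = 0" if "y \<in> U" for y
    using that closure_subset[of "{x. \<phi> x \<noteq> 0}"] unfolding U_def by blast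
  have U: "open U" "x \<in> U" using assms by (simp_all add: U_def open_Compl)
  then show "\<phi> x = 0" using zero by blast
  have "((\<lambda>_. 0) has_derivative (\<lambda>_. 0)) (at x)" by simp
  then have "(\<phi> has_derivative (\<lambda>_. 0)) (at x)"
    by (rule has_derivative_transform_within_open[OF _ U]) (simp add: zero)
  then have "frechet_derivative \<phi> (at x) = (\<lambda>_. 0)"
    by (rule frechet_derivative_at[symmetric])
  then show "grad \<phi> x = 0" by (simp add: grad_def partial_deriv_def vec_eq_iff)
qed

text \<open>Passes from the Bochner integrals over the domain to nonnegative integrals over the
  whole space. Compact support gives integrability, so the default value 0 of a divergent Bochner
  integral does not interfere.\<close>

lemma nn_integral_eq_set_lebesgue_integral:
  fixes f :: "'a::euclidean_space \<Rightarrow> real"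
  assumes f: "continuous_on UNIV f" "\<And>x. 0 \<le> f x"
    and S: "compact S" "S \<subseteq> \<Omega>" "\<And>x. x \<notin> S \<Longrightarrow> f x = 0"
  shows "(\<integral>\<^sup>+x. ennreal (f x) \<partial>lborel) = ennreal (LINT x:\<Omega>|lborel. f x)"
proof -
  have "integrable lborel (\<lambda>x. indicator S x *\<^sub>R f x)"
    using S f by (intro borel_integrable_compact continuous_on_subset[OF f(1)]) auto
  moreover have "(\<lambda>x. indicator S x *\<^sub>R f x) = f"
    using S by (auto simp: indicator_def fun_eq_iff)
  ultimately have "integrable lborel f" by simp
  then have "(\<integral>\<^sup>+x. ennreal (f x) \<partial>lborel) = ennreal (LINT x|lborel. f x)"
    using f by (intro nn_integral_eq_integral) auto
  also have "(LINT x|lborel. f x) = (LINT x:\<Omega>|lborel. f x)"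
    unfolding set_lebesgue_integral_def using S
    by (intro Bochner_Integration.integral_cong) (auto simp: indicator_def)
  finally show ?thesis .
qed

lemma emeasure_lborel_cube_cart:
  fixes l u :: "real ^ 'n::finite"
  assumes "\<And>i. u $ i - l $ i = s" "0 \<le> s"
  shows "emeasure lborel (box l u) = ennreal (s ^ CARD('n))"
    "emeasure lborel (cbox l u) = ennreal (s ^ CARD('n))"
proof -
  have b: "(u - l) \<bullet> b = s" if "b \<in> Basis" for b
  proof -
    from that obtain i where "b = axis i 1" by (auto simp: Basis_vec_def)
    then show ?thesis using assms(1)[of i] by (simp add: inner_axis)
  qed
  then have "l \<bullet> b \<le> u \<bullet> b" if "b \<in> Basis" for b
    using assms(2) b[OF that] by (simp add: inner_diff_left)
  moreover have "(\<Prod>b\<in>Basis. (u - l) \<bullet> b) = s ^ CARD('n)"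
    using b by simp
  ultimately show "emeasure lborel (box l u) = ennreal (s ^ CARD('n))"
    "emeasure lborel (cbox l u) = ennreal (s ^ CARD('n))"
    by simp_all
qed

text \<open>For \<open>h\<close> in a suitable cube of side \<open>r\<close>, \<open>x + h\<close>
  is a zero of the function, so the value at \<open>x\<close> is an increment. The factor on the
  left is the volume of this cube divided by \<open>2 * r * N\<close>, a bound for the length of
  \<open>h\<close>.\<close>

lemma le_dilate_average_if_zero_large_coords:
  fixes \<phi> :: "real ^ 'n::finite \<Rightarrow> real" and r :: real
  defines "K \<equiv> cbox (\<chi> i. - 2 * r) (\<chi> i. 2 * r) :: (real ^ 'n) set"
  assumes r: "0 < r" and diff: "\<And>x. \<phi> differentiable (at x)"
    and cont: "continuous_on UNIV (grad \<phi>)"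
    and zero: "\<And>y. (\<And>i. r < \<bar>y $ i\<bar>) \<Longrightarrow> \<phi> y = 0"
  shows "ennreal (r powr (real CARD('n) - 1) / (2 * real CARD('n)) * \<bar>\<phi> x\<bar>)
    \<le> (\<integral>\<^sup>+t. indicator {0..1} t * dilate_integral K (\<lambda>x. norm (grad \<phi> x)) t x \<partial>lborel)"
proof -
  define N where "N = real CARD('n)"
  define g where "g x = norm (grad \<phi> x)" for x
  define L where "L h = (\<integral>\<^sup>+t. indicator {0..1} t * ennreal (g (x + t *\<^sub>R h)) \<partial>lborel)" for h
  \<comment> \<open>The signs follow those of \<open>x\<close>, so each shift moves a coordinate
    away from 0. Openness of the box makes the resulting inequality
    \<open>r < \<bar>(x + h) $ i\<bar>\<close> strict.\<close>
  define S where "S = box (\<chi> i. if 0 \<le> x $ i then r else - 2 * r)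
    (\<chi> i. if 0 \<le> x $ i then 2 * r else - r)"
  let ?J = "\<integral>\<^sup>+t. indicator {0..1} t * dilate_integral K g t x \<partial>lborel"
  have N: "0 < N" by (simp add: N_def)
  have [measurable]: "g \<in> borel_measurable borel"
    unfolding g_def by (intro borel_measurable_continuous_onI continuous_on_norm cont)
  have [measurable]: "S \<in> sets borel" "K \<in> sets borel" by (simp_all add: S_def K_def)
  have S_K: "S \<subseteq> K"
  proof
    fix h assume h: "h \<in> S"
    have "- 2 * r \<le> h $ i \<and> h $ i \<le> 2 * r" for i
      using h[unfolded S_def mem_box_cart, rule_format, of i] r by (auto split: if_splits)
    then show "h \<in> K" by (simp add: K_def mem_box_cart)
  qed
  have norm_K: "norm h \<le> 2 * r * N" if "h \<in> K" for h
  proof -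
    have "norm h \<le> (\<Sum>i\<in>UNIV. \<bar>h $ i\<bar>)" by (rule norm_le_l1_cart)
    also have "\<dots> \<le> (\<Sum>i\<in>(UNIV :: 'n set). 2 * r)"
      using that by (intro sum_mono) (auto simp: K_def mem_box_cart abs_le_iff minus_le_iff)
    finally show ?thesis by (simp add: N_def mult.commute)
  qed
  have S_zero: "\<phi> (x + h) = 0" if h: "h \<in> S" for h
  proof (rule zero)
    fix i show "r < \<bar>(x + h) $ i\<bar>"
      using h[unfolded S_def mem_box_cart, rule_format, of i] by (auto split: if_splits)
  qed
  have "ennreal (r ^ CARD('n)) * ennreal \<bar>\<phi> x\<bar> = emeasure lborel S * ennreal \<bar>\<phi> x\<bar>"
    unfolding S_def using r by (subst emeasure_lborel_cube_cart(1)[where s = r]) auto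
  also have "\<dots> = (\<integral>\<^sup>+h. indicator S h * ennreal \<bar>\<phi> x\<bar> \<partial>lborel)"
    by (simp add: nn_integral_multc)
  also have "\<dots> \<le> (\<integral>\<^sup>+h. ennreal (2 * r * N) * (indicator K h * L h) \<partial>lborel)"
  proof (rule nn_integral_mono)
    fix h
    show "indicator S h * ennreal \<bar>\<phi> x\<bar> \<le> ennreal (2 * r * N) * (indicator K h * L h)"
    proof (cases "h \<in> S")
      case True
      then have "ennreal \<bar>\<phi> x\<bar> \<le> ennreal (norm h) * L h"
        using increment_le_line_integral_grad[OF diff cont, of x h] S_zero[OF True]
        by (simp add: L_def g_def)
      also have "\<dots> \<le> ennreal (2 * r * N) * L h"
        using norm_K S_K True by (intro mult_right_mono ennreal_leI) auto
      finally show ?thesis using True S_K by auto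
    qed simp
  qed
  also have "\<dots> = ennreal (2 * r * N) * (\<integral>\<^sup>+h. indicator K h * L h \<partial>lborel)"
    unfolding L_def by (rule nn_integral_cmult) measurable
  also have "(\<integral>\<^sup>+h. indicator K h * L h \<partial>lborel)
      = (\<integral>\<^sup>+h. \<integral>\<^sup>+t. indicator {0..1} t * ennreal (indicator K h * g (x + t *\<^sub>R h)) \<partial>lborel \<partial>lborel)"
    unfolding L_def by (intro nn_integral_cong) (simp split: split_indicator)
  \<comment> \<open>Tonelli's theorem turns averages of line integrals into an integral of dilated
    averages.\<close>
  also have "\<dots> = (\<integral>\<^sup>+t. \<integral>\<^sup>+h. indicator {0..1} t * ennreal (indicator K h * g (x + t *\<^sub>R h)) \<partial>lborel \<partial>lborel)"
    by (rule lborel_pair.Fubini') measurable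
  also have "\<dots> = ?J"
    unfolding dilate_integral_def by (rule nn_integral_cong, rule nn_integral_cmult) measurable
  finally have "ennreal (1 / (2 * r * N)) * (ennreal (r ^ CARD('n)) * ennreal \<bar>\<phi> x\<bar>)
      \<le> ennreal (1 / (2 * r * N)) * (ennreal (2 * r * N) * ?J)"
    by (rule mult_left_mono) simp
  also have "\<dots> = ?J"
  proof -
    have "ennreal (1 / (2 * r * N)) * ennreal (2 * r * N) = 1"
      using r N by (subst ennreal_mult[symmetric]) auto
    then show ?thesis by (simp only: mult.assoc[symmetric] mult_1_left)
  qed
  also have "ennreal (1 / (2 * r * N)) * (ennreal (r ^ CARD('n)) * ennreal \<bar>\<phi> x\<bar>)
      = ennreal (r powr (N - 1) / (2 * N) * \<bar>\<phi> x\<bar>)"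
  proof -
    have "r powr (N - 1) = r ^ CARD('n) / r"
      using r by (simp add: N_def powr_diff powr_realpow)
    then have "1 / (2 * r * N) * (r ^ CARD('n) * \<bar>\<phi> x\<bar>) = r powr (N - 1) / (2 * N) * \<bar>\<phi> x\<bar>"
      by simp
    moreover have "ennreal (1 / (2 * r * N)) * (ennreal (r ^ CARD('n)) * ennreal \<bar>\<phi> x\<bar>)
        = ennreal (1 / (2 * r * N) * (r ^ CARD('n) * \<bar>\<phi> x\<bar>))"
      by (subst ennreal_mult, use r N in simp, use r in simp, subst ennreal_mult) (use r in simp_all)
    ultimately show ?thesis by (simp only:)
  qed
  finally show ?thesis by (simp add: N_def g_def)
qed

section \<open>Energy of normalised test functions and the final constant\<close>

text \<open>The bounds of the previous parts are applied to a multiple of the absolute value of the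
  test function, whose norm is 1. Written with \<open>e\<close>, the finite and the infinite case of
  \<open>q\<close> take the same form.\<close>

lemma normalized_test_function_energy:
  fixes \<phi> :: "real ^ 'n::finite \<Rightarrow> real" and p r :: real and q :: ereal
  defines "N \<equiv> real CARD('n)" and "e \<equiv> exponent_ratio p q"
  assumes \<phi>: "\<phi> \<in> test_functions \<Omega>" and norm1: "Lq_norm q \<Omega> \<phi> = 1"
    and r: "0 < r" and small: "\<And>y. y \<in> \<Omega> \<Longrightarrow> \<exists>i. \<bar>y $ i\<bar> \<le> r"
    and p: "1 < p" "ereal p \<le> q" and a: "N * (1 - e) < p"
  shows "(r powr (N - 1) / (2 * N)) powr p
    \<le> (1 / (1 - N * (1 - e) / p)) powr p * ((4 * r) powr N) powr (e + p - 1)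
      * (LINT x:\<Omega>|lborel. norm (grad \<phi> x) powr p)"
proof -
  define S where "S = closure {x. \<phi> x \<noteq> 0}"
  define k where "k = r powr (N - 1) / (2 * N)"
  define A where "A = 1 / (1 - N * (1 - e) / p)"
  define \<kappa> where "\<kappa> = (4 * r) powr N"
  define G where "G = (LINT x:\<Omega>|lborel. norm (grad \<phi> x) powr p)"
  define K :: "(real ^ 'n) set" where "K = cbox (\<chi> i. - 2 * r) (\<chi> i. 2 * r)"
  have N: "0 < N" by (simp add: N_def)
  have k: "0 < k" using r N by (simp add: k_def)
  have A: "0 < A" using a p by (simp add: A_def field_simps)
  have \<kappa>: "emeasure lborel K = ennreal \<kappa>" "0 < \<kappa>"
    unfolding K_def using r
    by (subst emeasure_lborel_cube_cart(2)[where s = "4 * r"]) (use r in \<open>auto simp: \<kappa>_def N_def powr_realpow\<close>)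
  have S: "compact S" "S \<subseteq> \<Omega>" using \<phi> by (auto simp: S_def test_functions_def)
  have zero: "\<phi> x = 0" "grad \<phi> x = 0" if "x \<notin> S" for x
    using that zero_outside_support unfolding S_def by blast+
  note diff = test_function_differentiable[OF \<phi>] and contg = test_function_continuous_grad[OF \<phi>]
  have cont: "continuous_on UNIV \<phi>"
    using diff by (simp add: differentiable_imp_continuous_within continuous_on_eq_continuous_within)
  have [measurable]: "\<phi> \<in> borel_measurable borel"
    by (rule borel_measurable_continuous_onI[OF cont])
  have meas: "(\<lambda>x. norm (grad \<phi> x)) \<in> borel_measurable borel" "K \<in> sets borel"
    by (auto intro!: borel_measurable_continuous_onI continuous_on_norm contg simp: K_def)
  have G: "(\<integral>\<^sup>+x. ennreal (norm (grad \<phi> x) powr p) \<partial>lborel) = ennreal G"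
    unfolding G_def using S zero p
    by (intro nn_integral_eq_set_lebesgue_integral[of _ S])
      (auto intro!: continuous_on_powr' continuous_on_norm contg)
  have G0: "0 \<le> G"
    unfolding G_def set_lebesgue_integral_def by (intro integral_nonneg_AE) auto
  have u: "ennreal (k * \<bar>\<phi> x\<bar>)
      \<le> (\<integral>\<^sup>+t. indicator {0..1} t * dilate_integral K (\<lambda>x. norm (grad \<phi> x)) t x \<partial>lborel)" for x
    unfolding k_def N_def K_def
  proof (rule le_dilate_average_if_zero_large_coords[OF r diff contg])
    fix y :: "real ^ 'n" assume "\<And>i. r < \<bar>y $ i\<bar>"
    then have "y \<notin> \<Omega>" using small[of y] by (auto simp: not_le[symmetric])
    then show "\<phi> y = 0" using zero S by blast
  qed
  have "k powr p \<le> A powr p * \<kappa> powr (e + p - 1) * G"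
  proof (cases "q = \<infinity>")
    case True
    then have e: "e = 0" by (simp add: e_def exponent_ratio_def)
    define D where "D = A * (\<kappa> powr (p - 1) * G) powr (1 / p)"
    have "k * \<bar>\<phi> x\<bar> \<le> D" for x
      using Linfty_bound_dilate_average[OF meas _ \<kappa> _ _ G G0 _ u] p a k
      by (simp add: e D_def A_def N_def)
    then have "\<bar>\<phi> x\<bar> \<le> D / k" for x using k by (simp add: field_simps)
    then have "esssup (restrict_space lborel \<Omega>) (\<lambda>x. ereal \<bar>\<phi> x\<bar>) \<le> ereal (D / k)"
      \<comment> \<open>The essential supremum is 1 by normalisation, whence
        \<open>1 \<le> D / k\<close>.\<close>
      by (intro esssup_I AE_I2) (auto intro: measurable_restrict_space1)
    then have "k \<le> D"
      using norm1 True k by (simp add: Lq_norm_def one_ereal_def field_simps)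
    then have "k powr p \<le> D powr p" using k p by (intro powr_mono2) auto
    also have "\<dots> = A powr p * \<kappa> powr (e + p - 1) * G"
      using A \<kappa> G0 p by (simp add: D_def powr_mult powr_powr e)
    finally show ?thesis .
  next
    case False
    then obtain q' where q': "q = ereal q'" "p \<le> q'" using p by (cases q) auto
    have "0 < q'" using p q' by simp
    have e: "e = p / q'" using q' by (simp add: e_def exponent_ratio_def)
    have a_eq: "N * (1 / p - 1 / q') = N * (1 - e) / p"
      using p q' by (simp add: e field_simps)
    define m where "m = (LINT x:\<Omega>|lborel. \<bar>\<phi> x\<bar> powr q')"
    have "m powr (1 / q') = 1" using norm1 q' by (simp add: Lq_norm_def m_def one_ereal_def)
    moreover have "0 \<le> m"
      unfolding m_def set_lebesgue_integral_def by (intro integral_nonneg_AE) auto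
    moreover have "m = (m powr (1 / q')) powr q'"
      using p q' \<open>0 \<le> m\<close> by (simp add: powr_powr)
    ultimately have "m = 1" by simp
    have "(\<integral>\<^sup>+x. ennreal (\<bar>\<phi> x\<bar> powr q') \<partial>lborel) = ennreal m"
      unfolding m_def using S zero \<open>0 < q'\<close>
      by (intro nn_integral_eq_set_lebesgue_integral[of _ S])
        (auto intro!: continuous_on_powr' continuous_on_rabs cont)
    then have "ennreal (k powr q') = (\<integral>\<^sup>+x. ennreal ((k * \<bar>\<phi> x\<bar>) powr q') \<partial>lborel)"
      using k by (simp add: \<open>m = 1\<close> powr_mult ennreal_mult nn_integral_cmult)
    also have "\<dots> \<le> ennreal (A powr q' * \<kappa> powr (1 + (p - 1) * q' / p) * G powr (q' / p))"
      using Lq_bound_dilate_average[OF meas _ \<kappa> _ q'(2) _ G G0 _ u] p a k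
      by (simp add: a_eq[unfolded N_def] A_def N_def)
    finally have "k powr q' \<le> A powr q' * \<kappa> powr (1 + (p - 1) * q' / p) * G powr (q' / p)"
      by (subst (asm) ennreal_le_iff) auto
    \<comment> \<open>The power \<open>p / q'\<close> makes the bound linear in the energy
      \<open>G\<close>.\<close>
    then have "(k powr q') powr (p / q')
        \<le> (A powr q' * \<kappa> powr (1 + (p - 1) * q' / p) * G powr (q' / p)) powr (p / q')"
      using p q' by (intro powr_mono2) auto
    moreover have "(1 + (p - 1) * q' / p) * (p / q') = e + p - 1"
      using p q' by (simp add: e field_simps)
    ultimately show ?thesis
      using p q' A \<kappa> G0 by (simp add: powr_mult powr_powr)
  qed
  then show ?thesis by (simp add: k_def A_def \<kappa>_def G_def)
qed

text \<open>Puts the three ranges of \<open>q\<close> into one inequality, which says that the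
  exponent of the singularity at \<open>t = 0\<close> is below 1. For \<open>q = \<infinity>\<close>
  the hypotheses leave only \<open>N < p\<close>; for finite \<open>q\<close> the claim is cleared
  of denominators.\<close>

lemma subcritical_exponent:
  fixes p N :: real and q :: ereal
  assumes "1 < p" "0 < N" "ereal p \<le> q" "p < N \<Longrightarrow> q < ereal (N * p / (N - p))" "p = N \<Longrightarrow> q < \<infinity>"
  shows "N * (1 - exponent_ratio p q) < p"
proof (cases "q = \<infinity>")
  case True
  then show ?thesis using assms by (cases p N rule: linorder_cases) (auto simp: exponent_ratio_def)
next
  case False
  then obtain q' where q': "q = ereal q'" "p \<le> q'" using assms by (cases q) auto
  have "N * (q' - p) < p * q'"
  proof (cases p N rule: linorder_cases)
    case less
    then have "q' * (N - p) < N * p" using assms(4) q' by (simp add: pos_less_divide_eq)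
    then show ?thesis by (simp add: algebra_simps)
  next
    case equal
    then show ?thesis using assms by (simp add: algebra_simps)
  next
    case greater
    then have "N * (q' - p) \<le> p * (q' - p)" using q' by (intro mult_right_mono) auto
    also have "\<dots> < p * q'" using assms by (simp add: algebra_simps)
    finally show ?thesis .
  qed
  then show ?thesis using q' assms by (simp add: exponent_ratio_def field_simps)
qed

theorem proposition3p4:
  fixes p N :: real and q :: ereal
  defines "N \<equiv> real CARD('n::finite)"
  assumes "1 < p"
    and "ereal p \<le> q"
    and "p < N \<Longrightarrow> q < ereal (N * p / (N - p))"
    and "p = N \<Longrightarrow> q < \<infinity>"
  shows "\<exists>c>0. \<forall>\<Omega> :: (real ^ 'n) set.
           open \<Omega> \<and> \<Omega> \<noteq> {} \<and> \<Omega> \<noteq> UNIV \<and> steiner_symmetric \<Omega> \<longrightarrow>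
             0 < lambda_pq p q \<Omega> \<and>
             ereal (c * (1 / inradius \<Omega>) powr (p - N + N * exponent_ratio p q)) \<le> lambda_pq p q \<Omega>"
proof -
  define e where "e = exponent_ratio p q"
  define A where "A = 1 / (1 - N * (1 - e) / p)"
  \<comment> \<open>Collects the factors of the energy bound that do not involve the
    inradius.\<close>
  define c where "c = 1 / ((2 * N * A) powr p * (4 powr N) powr (e + p - 1))"
  have N: "0 < N" by (simp add: N_def)
  have a: "N * (1 - e) < p"
    unfolding e_def using assms(2-) N by (intro subcritical_exponent) auto
  have A: "0 < A" using a assms(2) by (simp add: A_def field_simps)
  have c: "0 < c" using N A by (simp add: c_def)
  have "0 < lambda_pq p q \<Omega> \<and> ereal (c * (1 / inradius \<Omega>) powr (p - N + N * e)) \<le> lambda_pq p q \<Omega>"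
    if \<Omega>: "open \<Omega>" "\<Omega> \<noteq> {}" "\<Omega> \<noteq> UNIV" "steiner_symmetric \<Omega>" for \<Omega> :: "(real ^ 'n) set"
  proof -
    define r where "r = inradius \<Omega>"
    have r: "0 < r" unfolding r_def by (rule inradius_pos[OF \<Omega>(4,2,3)])
    have small: "\<exists>i. \<bar>y $ i\<bar> \<le> r" if "y \<in> \<Omega>" for y
      unfolding r_def by (rule small_coord_if_mem[OF \<Omega>(4,2,3) that])
    have le: "ereal (c * (1 / r) powr (p - N + N * e)) \<le> lambda_pq p q \<Omega>"
      unfolding lambda_pq_def
    proof (rule INF_greatest)
      fix \<phi> assume "\<phi> \<in> {\<phi> \<in> test_functions \<Omega>. Lq_norm q \<Omega> \<phi> = 1}"
      then have \<phi>: "\<phi> \<in> test_functions \<Omega>" "Lq_norm q \<Omega> \<phi> = 1" by auto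
      let ?G = "LINT x:\<Omega>|lborel. norm (grad \<phi> x) powr p"
      have "(r powr (N - 1) / (2 * N)) powr p \<le> A powr p * ((4 * r) powr N) powr (e + p - 1) * ?G"
        unfolding A_def e_def N_def
        using normalized_test_function_energy[OF \<phi> r small assms(2,3)] a
        by (simp add: N_def e_def)
      moreover have "(r powr (N - 1) / (2 * N)) powr p
          = (c * (1 / r) powr (p - N + N * e)) * (A powr p * ((4 * r) powr N) powr (e + p - 1))"
      proof -
        have "(1 / r) powr (p - N + N * e) = r powr (- (p - N + N * e))"
          using r powr_minus_divide[of r "p - N + N * e"] by (simp add: powr_divide)
        moreover have "((4 * r) powr N) powr (e + p - 1) = (4 powr N) powr (e + p - 1) * r powr (N * (e + p - 1))"
          using r by (simp add: powr_mult powr_powr)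
        \<comment> \<open>The powers of \<open>r\<close> on both sides of the energy bound match
          precisely for the exponent in the claim.\<close>
        moreover have "r powr (- (p - N + N * e)) * r powr (N * (e + p - 1)) = r powr ((N - 1) * p)"
          unfolding powr_add[symmetric] by (simp add: algebra_simps)
        moreover have "(r powr (N - 1) / (2 * N)) powr p = r powr ((N - 1) * p) / (2 * N) powr p"
          using r N by (simp add: powr_divide powr_powr)
        moreover have "(2 * N * A) powr p = (2 * N) powr p * A powr p"
          using N A by (simp add: powr_mult)
        ultimately show ?thesis
          using N A by (simp add: c_def)
      qed
      moreover have "0 < A powr p * ((4 * r) powr N) powr (e + p - 1)" using A r by simp
      ultimately have "c * (1 / r) powr (p - N + N * e) \<le> ?G"
        by (metis mult.commute mult_le_cancel_left_pos)
      then show "ereal (c * (1 / r) powr (p - N + N * e)) \<le> ereal ?G" by simp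
    qed
    \<comment> \<open>Positivity of the infimum follows from the quantitative bound, as the inradius
      is positive.\<close>
    moreover have "0 < ereal (c * (1 / r) powr (p - N + N * e))" using c r by simp
    ultimately show ?thesis unfolding r_def by (meson less_le_trans)
  qed
  then show ?thesis using c unfolding e_def by blast
qed

end
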